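(* Let $q,\upsilon,\gamma_1,\gamma_2,\gamma_3,\gamma_4,\tau,w\in\mathbb{C}$ with $\operatorname{Re}(q)>0$, $\operatorname{Re}(\upsilon)>0$, $\gamma_3,\gamma_4\notin\{0,-1,-2,\dots\}$ and $\operatorname{Re}(\tau)>0$. Let $b\in\mathbb{R}$, $t>b$ and $-\tfrac14<z<\tfrac14$. Then $${}_{t}\mathbb{I}_{b^{+}}^{\tau}\left[(t-b)^{q-1}E_{\gamma_{3},\gamma_{4};q;\upsilon}^{(\gamma_{1};\gamma_{2})}(z,w(t-b))\right]=(t-b)^{q+\tau-1}E_{\gamma_{3},\gamma_{4};q+\tau;\upsilon}^{(\gamma_{1};\gamma_{2})}(z,w(t-b)).$$
   Context: $(a)_n$ is the Pochhammer symbol. The bivariate I-Konhauser Mittag-Leffler function is $$E_{\gamma_{3},\gamma_{4};q;\upsilon}^{(\gamma_{1};\gamma_{2})}(z,t)=\sum_{l=0}^{\infty}\sum_{n=0}^{\infty}\frac{(-1)^{n}(\gamma_{1})_{2n}(\gamma_{2})_{l+n}\,z^{n}t^{\upsilon l}}{(\gamma_{3})_{n}(\gamma_{4})_{n}\,\Gamma(q+\upsilon l)\,n!\,l!},$$ for $\operatorname{Re}(q)>0$, $\operatorname{Re}(\upsilon)>0$, $\gamma_3,\gamma_4\notin\{0,-1,-2,\dots\}$, considered for $-\frac14<z<\frac14$. For $s>0$, $(ws)^{\upsilon l}$ means $(w^{\upsilon})^l s^{\upsilon l}$ with a fixed choice of $w^\upsilon$ (and $w^{\upsilon}=0$ if $w=0$).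 The Riemann-Liouville fractional integral is ${}_{t}\mathbb{I}_{b^{+}}^{\tau}[h](t)=\frac{1}{\Gamma(\tau)}\int_b^t(t-y)^{\tau-1}h(y)\,dy$, $\operatorname{Re}(\tau)>0$, $t>b$. *)

theory Defs
  imports "HOL-Analysis.Analysis"
begin

text \<open>
  \<open>W\<close> is one of the values of the (in general multivalued) power \<open>w ^ \<upsilon>\<close>,
  i.e. \<open>exp (\<upsilon> * L)\<close> for an arbitrary logarithm \<open>L\<close> of \<open>w\<close>; the only value for \<open>w = 0\<close> is \<open>0\<close>.
\<close>

definition is_power_value :: "complex \<Rightarrow> complex \<Rightarrow> complex \<Rightarrow> bool" where
  "is_power_value w \<upsilon> W \<longleftrightarrow>
     (if w = 0 then W = 0 else (\<exists>L. exp L = w \<and> W = exp (\<upsilon> * L)))"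

text \<open>
  The bivariate I-Konhauser Mittag-Leffler function at \<open>(z, w * s)\<close> for \<open>s > 0\<close>. Its second
  argument enters only through the powers \<open>(w * s) ^ (\<upsilon> * l)\<close>, which mean \<open>W ^ l * s ^ (\<upsilon> * l)\<close>
  for a fixed value \<open>W\<close> of \<open>w ^ \<upsilon>\<close>, the power of \<open>s\<close> being the principal one. The function
  therefore takes \<open>W\<close> and \<open>s\<close> in place of \<open>w * s\<close>; the value at a positive real second
  argument \<open>s\<close> is the case \<open>W = 1\<close>.
\<close>

definition IKonhauser_ML ::
    "complex \<Rightarrow> complex \<Rightarrow> complex \<Rightarrow> complex \<Rightarrow> complex \<Rightarrow> complex \<Rightarrow> real \<Rightarrow> complex \<Rightarrow> real \<Rightarrow> complex"
  where
  "IKonhauser_ML \<gamma>\<^sub>1 \<gamma>\<^sub>2 \<gamma>\<^sub>3 \<gamma>\<^sub>4 q \<upsilon> z W s =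
     (\<Sum>l. \<Sum>n. ((-1) ^ n * pochhammer \<gamma>\<^sub>1 (2 * n) * pochhammer \<gamma>\<^sub>2 (l + n)
                  * of_real z ^ n * (W ^ l * of_real s powr (\<upsilon> * of_nat l)))
               / (pochhammer \<gamma>\<^sub>3 n * pochhammer \<gamma>\<^sub>4 n * Gamma (q + \<upsilon> * of_nat l) * fact n * fact l))"

definition RL_integrable :: "real \<Rightarrow> complex \<Rightarrow> (real \<Rightarrow> complex) \<Rightarrow> real \<Rightarrow> bool" where
  "RL_integrable b \<tau> h t \<longleftrightarrow>
     set_integrable lborel {b<..<t} (\<lambda>y. of_real (t - y) powr (\<tau> - 1) * h y)"

definition RL_integral :: "real \<Rightarrow> complex \<Rightarrow> (real \<Rightarrow> complex) \<Rightarrow> real \<Rightarrow> complex" where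
  "RL_integral b \<tau> h t =
     1 / Gamma \<tau> * (LINT y:{b<..<t}|lborel. of_real (t - y) powr (\<tau> - 1) * h y)"

end

theory Submission
  imports Defs
begin

text \<open>
  For fixed \<open>z\<close> the function is a series in the powers
  \<open>s powr (\<upsilon> * l)\<close> whose \<open>l\<close>-th coefficient is \<open>A l * W ^ l / Gamma (q + \<upsilon> * l)\<close>, where \<open>A l\<close>, the sum
  over \<open>n\<close>, depends neither on \<open>q\<close> nor on \<open>s\<close>. The fractional integral of order \<open>\<tau>\<close> sends
  \<open>(y - b) powr (q + \<upsilon> * l - 1)\<close> to
  \<open>Gamma (q + \<upsilon> * l) / Gamma (q + \<tau> + \<upsilon> * l) * (t - b) powr (q + \<tau> + \<upsilon> * l - 1)\<close>, which is the complex
  Beta integral. So it replaces \<open>q\<close> by \<open>q + \<tau>\<close> in the Gamma factor of each term and multiplies the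
  prefactor by \<open>(t - b) powr \<tau>\<close>, which is the claim once sum and integral are exchanged
  (\<open>RL_power_series\<close>).

  The Beta integral (\<open>Beta_integral_complex\<close>) comes from the convolution of two Gamma densities.
  The exchange needs the series to converge absolutely at \<open>s = t - b\<close>. For this,
  \<open>\<bar>z\<bar> < 1 / 4\<close> makes the sum over \<open>n\<close> converge geometrically and \<open>A l\<close> grow at most
  geometrically in \<open>l\<close> (\<open>IKonhauser_coeff_bound\<close>), while \<open>Gamma (q + \<upsilon> * l)\<close> grows faster
  than any geometric sequence (\<open>Gamma_arithmetic_progression_superexponential\<close>). For
  complex \<open>\<upsilon>\<close> the latter is not obvious from the real case, because \<open>\<bar>Gamma (x + i y)\<bar>\<close> decays
  as \<open>\<bar>y\<bar>\<close> grows. It holds because \<open>\<bar>Gamma (x + i y)\<bar> \<ge> Gamma x * exp (- y\<^sup>2 / x)\<close> for \<open>x \<ge> 1\<close>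
  (\<open>norm_Gamma_ge_Gamma_Re\<close>): along \<open>q + \<upsilon> * l\<close> the quotient \<open>\<bar>y\<bar> / x\<close> is bounded, so the loss is at most
  exponential, and \<open>Gamma x\<close> outgrows every exponential.
\<close>

section \<open>Lower bounds for the Gamma function\<close>

lemma Gamma_nonzero_right_half_plane:
  fixes z :: complex
  assumes "Re z > 0"
  shows "Gamma z \<noteq> 0"
proof
  assume "Gamma z = 0"
  then obtain n where "z = of_int n" "n \<le> 0"
    by (auto simp: Gamma_eq_zero_iff elim!: nonpos_Ints_cases)
  with assms show False by simp
qed

text \<open>Comparison with the telescoping sum of \<open>1 / (m - 1/2) - 1 / (m + 1/2) = 1 / (m\<^sup>2 - 1/4)\<close>.\<close>

lemma sum_inverse_squares_le:
  fixes x :: real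
  assumes "x \<ge> 1"
  shows "(\<Sum>k<n. 1 / (x + real k)\<^sup>2) \<le> 2 / x"
proof -
  have "(\<Sum>k<n. 1 / (x + real k)\<^sup>2) \<le> 1 / (x - 1/2) - 1 / (x + real n - 1/2)"
  proof (induction n)
    case (Suc n)
    define m where "m = x + real n"
    have "m \<ge> 1" using assms by (simp add: m_def)
    have "m\<^sup>2 \<ge> 1" using \<open>m \<ge> 1\<close> by simp
    then have "m\<^sup>2 * (m\<^sup>2 - 1/4) > 0" by (intro mult_pos_pos) linarith+
    then have "1 / m\<^sup>2 \<le> 1 / (m\<^sup>2 - 1/4)" by (intro divide_left_mono) auto
    also have "\<dots> = 1 / (m - 1/2) - 1 / (m + 1/2)"
      using \<open>m \<ge> 1\<close> \<open>m\<^sup>2 * (m\<^sup>2 - 1/4) > 0\<close> by (simp add: field_simps power2_eq_square)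
    finally show ?case using Suc by (simp add: m_def algebra_simps)
  qed simp
  also have "\<dots> \<le> 1 / (x - 1/2)"
    using assms by simp
  also have "\<dots> \<le> 2 / x"
    using assms by (simp add: field_simps)
  finally show ?thesis .
qed

text \<open>
  Each factor satisfies \<open>\<bar>z + k\<bar>\<^sup>2 = (Re z + k)\<^sup>2 (1 + (Im z)\<^sup>2 / (Re z + k)\<^sup>2)\<close>, and
  \<open>1 + u \<le> exp u\<close>.
\<close>

lemma norm_pochhammer_le_exp:
  fixes z :: complex
  assumes "Re z > 0"
  shows "norm (pochhammer z n)
           \<le> pochhammer (Re z) n * exp ((Im z)\<^sup>2 / 2 * (\<Sum>k<n. 1 / (Re z + real k)\<^sup>2))"
proof (induction n)
  case (Suc n)
  define m where "m = Re z + real n"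
  have "m > 0" using assms by (simp add: m_def)
  have "(norm (z + of_nat n))\<^sup>2 = m\<^sup>2 * (1 + (Im z)\<^sup>2 / m\<^sup>2)"
    using \<open>m > 0\<close> by (simp add: cmod_power2 m_def field_simps)
  also have "\<dots> \<le> m\<^sup>2 * exp ((Im z)\<^sup>2 / m\<^sup>2)"
    by (intro mult_left_mono exp_ge_add_one_self) auto
  also have "\<dots> = (m * exp ((Im z)\<^sup>2 / 2 * (1 / m\<^sup>2)))\<^sup>2"
    by (simp add: power_mult_distrib flip: exp_double)
  finally have step: "norm (z + of_nat n) \<le> m * exp ((Im z)\<^sup>2 / 2 * (1 / m\<^sup>2))"
    by (rule power2_le_imp_le) (use \<open>m > 0\<close> in auto)
  have "norm (pochhammer z (Suc n)) = norm (pochhammer z n) * norm (z + of_nat n)"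
    by (simp add: pochhammer_Suc norm_mult)
  also have "\<dots> \<le> (pochhammer (Re z) n * exp ((Im z)\<^sup>2 / 2 * (\<Sum>k<n. 1 / (Re z + real k)\<^sup>2)))
                     * (m * exp ((Im z)\<^sup>2 / 2 * (1 / m\<^sup>2)))"
    using assms by (intro mult_mono Suc.IH step) (auto intro!: mult_nonneg_nonneg pochhammer_nonneg)
  also have "\<dots> = pochhammer (Re z) (Suc n)
                     * exp ((Im z)\<^sup>2 / 2 * (\<Sum>k<Suc n. 1 / (Re z + real k)\<^sup>2))"
    by (simp add: pochhammer_Suc m_def distrib_left exp_add)
  finally show ?case .
qed simp

text \<open>
  In Euler's limit \<open>n! n\<^sup>z / (z (z + 1) \<dots> (z + n))\<close> the imaginary part of \<open>z\<close> changes only the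
  modulus of the denominator, so the bound on Pochhammer symbols passes to the limit.
\<close>

lemma norm_Gamma_ge_Gamma_Re:
  fixes z :: complex
  assumes "Re z \<ge> 1"
  shows "norm (Gamma z) \<ge> Gamma (Re z) * exp (- ((Im z)\<^sup>2 / Re z))"
proof (rule tendsto_le[OF sequentially_bot])
  show "(\<lambda>n. norm (Gamma_series z n)) \<longlonglongrightarrow> norm (Gamma z)"
    by (intro tendsto_norm Gamma_series_LIMSEQ)
  show "(\<lambda>n. Gamma_series (Re z) n * exp (- ((Im z)\<^sup>2 / Re z)))
          \<longlonglongrightarrow> Gamma (Re z) * exp (- ((Im z)\<^sup>2 / Re z))"
    by (intro tendsto_mult tendsto_const Gamma_series_LIMSEQ)
  show "\<forall>\<^sub>F n in sequentially. Gamma_series (Re z) n * exp (- ((Im z)\<^sup>2 / Re z)) \<le> norm (Gamma_series z n)"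
  proof (rule always_eventually, rule allI)
    fix n :: nat
    have pos: "pochhammer (Re z) (Suc n) > 0"
      using assms by (intro pochhammer_pos) auto
    have nz: "norm (pochhammer z (Suc n)) > 0"
    proof -
      have "z \<noteq> - of_nat k" for k
        using assms by (auto simp: complex_eq_iff)
      then show ?thesis by (auto simp: pochhammer_eq_0_iff)
    qed
    have "norm (pochhammer z (Suc n))
            \<le> pochhammer (Re z) (Suc n) * exp ((Im z)\<^sup>2 / 2 * (\<Sum>k<Suc n. 1 / (Re z + real k)\<^sup>2))"
      using assms by (intro norm_pochhammer_le_exp) auto
    also have "\<dots> \<le> pochhammer (Re z) (Suc n) * exp ((Im z)\<^sup>2 / 2 * (2 / Re z))"
      using pos sum_inverse_squares_le[OF assms, of "Suc n"]
      by (intro mult_left_mono iffD2[OF exp_le_cancel_iff]) auto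
    finally have le: "norm (pochhammer z (Suc n)) \<le> pochhammer (Re z) (Suc n) * exp ((Im z)\<^sup>2 / Re z)"
      by simp
    define N where "N = fact n * exp (Re z * ln (real n))"
    have "N \<ge> 0" by (simp add: N_def)
    have "N / (pochhammer (Re z) (Suc n) * exp ((Im z)\<^sup>2 / Re z)) \<le> N / norm (pochhammer z (Suc n))"
      by (intro divide_left_mono le \<open>N \<ge> 0\<close> mult_pos_pos pos nz) simp
    then show "Gamma_series (Re z) n * exp (- ((Im z)\<^sup>2 / Re z)) \<le> norm (Gamma_series z n)"
      by (simp add: Gamma_series_def N_def norm_mult norm_divide exp_minus field_simps)
  qed
qed

text \<open>Keep only the part of Euler's integral over \<open>{T..2 * T}\<close>.\<close>

lemma Gamma_real_ge_powr:
  fixes x T :: real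
  assumes "x \<ge> 1" "T > 0"
  shows "Gamma x \<ge> T powr x * exp (- 2 * T)"
proof (rule has_integral_le[OF _ Gamma_integral_real])
  have "((\<lambda>t. T powr (x - 1) * exp (- 2 * T)) has_integral
           (2 * T - T) *\<^sub>R (T powr (x - 1) * exp (- 2 * T))) {T..2 * T}"
    using has_integral_const_real[of "T powr (x - 1) * exp (- 2 * T)" T "2 * T"] assms by simp
  also have "(2 * T - T) *\<^sub>R (T powr (x - 1) * exp (- 2 * T)) = T powr x * exp (- 2 * T)"
    using assms by (simp add: powr_diff)
  finally show "((\<lambda>t. if t \<in> {T..2*T} then T powr (x - 1) * exp (- 2 * T) else 0) has_integral
                  T powr x * exp (- 2 * T)) {0..}"
    using assms by (subst has_integral_restrict) auto
next
  fix t :: real assume "t \<in> {0..}"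
  show "(if t \<in> {T..2*T} then T powr (x - 1) * exp (- 2 * T) else 0) \<le> t powr (x - 1) / exp t"
    using assms by (auto simp: divide_inverse exp_minus[symmetric] intro!: mult_mono powr_mono2)
qed (use assms in auto)

text \<open>
  Along \<open>q + \<upsilon> l\<close> the Gamma function outgrows every geometric sequence, although the points
  may leave the real axis: \<open>Re \<upsilon> > 0\<close> keeps them in a sector around it. This is what makes the
  series in \<open>l\<close> converge for every value of its argument.
\<close>

lemma Gamma_arithmetic_progression_superexponential:
  fixes q \<upsilon> :: complex and R :: real
  assumes "Re q > 0" "Re \<upsilon> > 0" "R > 0"
  shows "\<exists>C>0. \<forall>\<^sub>F l in sequentially. R ^ l \<le> C * norm (Gamma (q + \<upsilon> * of_nat l))"
proof -
  define K where "K = \<bar>Im q\<bar> + \<bar>Im \<upsilon>\<bar> / Re \<upsilon>"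
  define M where "M = \<bar>ln R\<bar> / Re \<upsilon>"
  define T where "T = exp (K\<^sup>2 + M)"
  have "K \<ge> 0" "M \<ge> 0" "T > 0"
    using assms by (auto simp: K_def M_def T_def)
  have "\<forall>\<^sub>F l in sequentially. real l \<ge> 1 / Re \<upsilon>"
    using filterlim_real_sequentially by (auto simp: filterlim_at_top)
  then have "\<forall>\<^sub>F l in sequentially. R ^ l \<le> exp (2 * T) * norm (Gamma (q + \<upsilon> * of_nat l))"
  proof eventually_elim
    case (elim l)
    define x where "x = Re q + Re \<upsilon> * real l"
    define y where "y = Im q + Im \<upsilon> * real l"
    have "Re \<upsilon> * real l \<ge> 1" using elim assms by (simp add: field_simps)
    then have x: "x \<ge> 1" "Re \<upsilon> * real l \<le> x" using assms by (auto simp: x_def)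
    \<comment> \<open>The points stay in the sector \<open>\<bar>y\<bar> \<le> K x\<close>, which turns the loss \<open>exp (- y\<^sup>2 / x)\<close> into
      an exponential in \<open>x\<close>; the choice of \<open>T\<close> absorbs it.\<close>
    have "\<bar>y\<bar> \<le> \<bar>Im q\<bar> * 1 + \<bar>Im \<upsilon>\<bar> / Re \<upsilon> * (Re \<upsilon> * real l)"
      unfolding y_def using assms abs_triangle_ineq[of "Im q" "Im \<upsilon> * real l"]
      by (simp add: abs_mult)
    also have "\<dots> \<le> \<bar>Im q\<bar> * x + \<bar>Im \<upsilon>\<bar> / Re \<upsilon> * x"
      using assms x by (intro add_mono mult_left_mono) auto
    finally have "\<bar>y\<bar> \<le> K * x" by (simp add: K_def algebra_simps)
    then have "\<bar>y\<bar>\<^sup>2 \<le> (K * x)\<^sup>2" by (rule power_mono) simp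
    then have y: "y\<^sup>2 / x \<le> K\<^sup>2 * x" using x by (simp add: field_simps power2_eq_square)
    have "R ^ l = exp (real l * ln R)"
      using assms by (simp add: exp_of_nat_mult)
    also have "real l * ln R \<le> M * (Re \<upsilon> * real l)"
      using assms by (simp add: M_def mult.commute mult_left_mono)
    also have "\<dots> \<le> M * x"
      using x \<open>M \<ge> 0\<close> by (intro mult_left_mono) auto
    also have "\<dots> = 2 * T + ((K\<^sup>2 + M) * x - 2 * T - K\<^sup>2 * x)" by (simp add: algebra_simps)
    also have "exp \<dots> = exp (2 * T) * (T powr x * exp (- 2 * T) * exp (- (K\<^sup>2 * x)))"
      by (simp add: T_def powr_def mult_ac flip: exp_add)
    also have "\<dots> \<le> exp (2 * T) * (Gamma x * exp (- (y\<^sup>2 / x)))"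
      using x \<open>T > 0\<close> y by (intro mult_left_mono mult_mono Gamma_real_ge_powr) auto
    also have "\<dots> \<le> exp (2 * T) * norm (Gamma (q + \<upsilon> * of_nat l))"
      using norm_Gamma_ge_Gamma_Re[of "q + \<upsilon> * of_nat l"] x
      by (intro mult_left_mono) (auto simp: x_def y_def)
    finally show ?case by simp
  qed
  then show ?thesis by (intro exI[of _ "exp (2 * T)"]) auto
qed

section \<open>Growth of the double coefficients\<close>

text \<open>The ratio test in quantitative form, with a constant valid for all \<open>n\<close>.\<close>

lemma geometric_bound_of_ratio:
  fixes f :: "nat \<Rightarrow> 'a :: real_normed_field" and c :: real
  assumes step: "\<And>n. f (Suc n) = f n * g n"
    and lim: "g \<longlonglongrightarrow> L" and c: "norm L < c"
  shows "\<exists>C>0. \<forall>n. norm (f n) \<le> C * c ^ n"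
proof -
  have "c > 0" using c norm_ge_zero[of L] by linarith
  have "\<forall>\<^sub>F n in sequentially. norm (g n) < c"
    using tendsto_norm[OF lim] c by (rule order_tendstoD)
  then obtain N where N: "\<And>n. n \<ge> N \<Longrightarrow> norm (g n) < c"
    by (auto simp: eventually_sequentially)
  define C where "C = 1 + (\<Sum>k\<le>N. norm (f k) / c ^ k)"
  have "norm (f n) \<le> C * c ^ n" for n
  proof (induction n)
    case 0
    have "norm (f 0) / c ^ 0 \<le> (\<Sum>k\<le>N. norm (f k) / c ^ k)"
      using \<open>c > 0\<close> by (intro member_le_sum) auto
    then show ?case by (simp add: C_def)
  next
    case (Suc n)
    show ?case
    proof (cases "Suc n \<le> N")
      case True
      have "norm (f (Suc n)) / c ^ Suc n \<le> (\<Sum>k\<le>N. norm (f k) / c ^ k)"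
        using \<open>c > 0\<close> True by (intro member_le_sum) auto
      then have "norm (f (Suc n)) / c ^ Suc n \<le> C" by (simp add: C_def)
      then show ?thesis using \<open>c > 0\<close> by (simp add: field_simps)
    next
      case False
      have "norm (f (Suc n)) = norm (f n) * norm (g n)" by (simp add: step norm_mult)
      also have "\<dots> \<le> (C * c ^ n) * c"
        using False N[of n] \<open>c > 0\<close> Suc by (intro mult_mono) (auto intro: order_trans[OF norm_ge_zero])
      finally show ?thesis by (simp add: mult_ac)
    qed
  qed
  moreover have "C > 0" unfolding C_def using \<open>c > 0\<close> by (intro add_pos_nonneg sum_nonneg) auto
  ultimately show ?thesis by blast
qed

text \<open>
  The summand of the Mittag-Leffler series without the factor
  \<open>W ^ l * s powr (\<upsilon> * l) / Gamma (q + \<upsilon> * l)\<close>, which is constant in \<open>n\<close>.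
\<close>

definition IKonhauser_coeff ::
    "complex \<Rightarrow> complex \<Rightarrow> complex \<Rightarrow> complex \<Rightarrow> real \<Rightarrow> nat \<Rightarrow> nat \<Rightarrow> complex" where
  "IKonhauser_coeff \<gamma>\<^sub>1 \<gamma>\<^sub>2 \<gamma>\<^sub>3 \<gamma>\<^sub>4 z l n =
     (-1) ^ n * pochhammer \<gamma>\<^sub>1 (2 * n) * pochhammer \<gamma>\<^sub>2 (l + n) * of_real z ^ n
       / (pochhammer \<gamma>\<^sub>3 n * pochhammer \<gamma>\<^sub>4 n * fact n * fact l)"

lemma pochhammer_over_fact_bound:
  fixes a :: complex and \<sigma> :: real
  assumes "\<sigma> > 1"
  shows "\<exists>C>0. \<forall>m. norm (pochhammer a m / fact m) \<le> C * \<sigma> ^ m"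
proof (rule geometric_bound_of_ratio)
  show "pochhammer a (Suc m) / fact (Suc m)
          = pochhammer a m / fact m * ((a + of_nat m) / of_nat (Suc m))" for m
    by (simp add: pochhammer_Suc divide_simps del: of_nat_Suc)
  have "(\<lambda>m. 1 + (a - 1) * inverse (of_nat (Suc m))) \<longlonglongrightarrow> 1 + (a - 1) * 0"
    by (intro tendsto_add tendsto_mult tendsto_const filterlim_compose[OF lim_inverse_n filterlim_Suc])
  moreover have "1 + (a - 1) * inverse (of_nat (Suc m)) = (a + of_nat m) / of_nat (Suc m)" for m
    using of_nat_neq_0[where 'a=complex, of m] by (simp add: field_simps del: of_nat_Suc) simp
  ultimately show "(\<lambda>m. (a + of_nat m) / of_nat (Suc m)) \<longlonglongrightarrow> 1" by simp
qed (use assms in auto)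

text \<open>
  Advancing \<open>n\<close> by one adds two factors to the first Pochhammer symbol, each of size about \<open>2 n\<close>;
  hence the limit ratio \<open>4 z\<close>, the origin of the radius \<open>1 / 4\<close>.
\<close>

lemma pochhammer_quotient_bound:
  fixes a c d :: complex and z \<rho> :: real
  assumes "4 * \<bar>z\<bar> < \<rho>"
  shows "\<exists>C>0. \<forall>n. norm (pochhammer a (2 * n) * of_real z ^ n / (pochhammer c n * pochhammer d n))
                      \<le> C * \<rho> ^ n"
proof (rule geometric_bound_of_ratio)
  let ?g = "\<lambda>n. (a + of_nat (2 * n)) * (a + of_nat (2 * n + 1)) * of_real z
                  / ((c + of_nat n) * (d + of_nat n))"
  show "pochhammer a (2 * Suc n) * of_real z ^ Suc n / (pochhammer c (Suc n) * pochhammer d (Suc n))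
          = pochhammer a (2 * n) * of_real z ^ n / (pochhammer c n * pochhammer d n) * ?g n" for n
    by (simp add: pochhammer_Suc mult_ac)
  have *: "(\<lambda>n. e / of_nat n) \<longlonglongrightarrow> 0" for e :: complex
    by (rule lim_const_over_n)
  have "(\<lambda>n. (a / of_nat n + 2) * ((a + 1) / of_nat n + 2) * of_real z
            / ((c / of_nat n + 1) * (d / of_nat n + 1)))
          \<longlonglongrightarrow> (0 + 2) * (0 + 2) * of_real z / ((0 + 1) * (0 + 1))"
    by (intro tendsto_intros *) auto
  moreover have "\<forall>\<^sub>F n in sequentially.
      (a / of_nat n + 2) * ((a + 1) / of_nat n + 2) * of_real z
            / ((c / of_nat n + 1) * (d / of_nat n + 1)) = ?g n"
    using eventually_gt_at_top[of 0]
  proof eventually_elim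
    case (elim n)
    have e: "a / of_nat n + 2 = (a + of_nat (2 * n)) / of_nat n"
      "(a + 1) / of_nat n + 2 = (a + of_nat (2 * n + 1)) / of_nat n"
      "c / of_nat n + 1 = (c + of_nat n) / of_nat n" "d / of_nat n + 1 = (d + of_nat n) / of_nat n"
      using elim by (auto simp: field_simps)
    show ?case unfolding e using elim by simp
  qed
  ultimately have "?g \<longlonglongrightarrow> (0 + 2) * (0 + 2) * of_real z / ((0 + 1) * (0 + 1))"
    by (rule Lim_transform_eventually)
  then show "?g \<longlonglongrightarrow> 4 * of_real z" by simp
  show "norm (4 * complex_of_real z) < \<rho>" using assms by (simp add: norm_mult)
qed

text \<open>A single term of the binomial expansion.\<close>

lemma binomial_mult_powers_le:
  fixes x y :: real
  assumes "x \<ge> 0" "y \<ge> 0"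
  shows "of_nat ((l + n) choose n) * x ^ n * y ^ l \<le> (x + y) ^ (l + n)"
proof -
  have "of_nat ((l + n) choose n) * x ^ n * y ^ (l + n - n)
          \<le> (\<Sum>k\<le>l + n. of_nat ((l + n) choose k) * x ^ k * y ^ (l + n - k))"
    using assms by (intro member_le_sum[where f = "\<lambda>k. of_nat ((l + n) choose k) * x ^ k * y ^ (l + n - k)"]) auto
  then show ?thesis by (simp add: binomial_ring)
qed

text \<open>
  Writing \<open>pochhammer \<gamma>\<^sub>2 (l + n) / (n! l!)\<close> as \<open>pochhammer \<gamma>\<^sub>2 (l + n) / (l + n)!\<close> times a binomial
  coefficient separates the two indices: the first factor grows at most like \<open>\<sigma> ^ (l + n)\<close> with
  \<open>\<sigma>\<close> as close to \<open>1\<close> as desired, and the binomial coefficient costs an arbitrarily small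
  increase of the rate in \<open>n\<close>, paid for by a large rate \<open>R\<close> in \<open>l\<close>.
\<close>

lemma IKonhauser_coeff_bound:
  fixes z :: real
  assumes "\<bar>z\<bar> < 1 / 4"
  shows "\<exists>C R \<eta>. C > 0 \<and> R > 0 \<and> 0 < \<eta> \<and> \<eta> < 1 \<and>
           (\<forall>l n. norm (IKonhauser_coeff \<gamma>\<^sub>1 \<gamma>\<^sub>2 \<gamma>\<^sub>3 \<gamma>\<^sub>4 z l n) \<le> C * R ^ l * \<eta> ^ n)"
proof -
  define \<rho> where "\<rho> = (4 * \<bar>z\<bar> + 1) / 2"
  define \<sigma> where "\<sigma> = (1 / \<rho> + 1) / 2"
  have \<rho>: "0 < \<rho>" "\<rho> < 1" "4 * \<bar>z\<bar> < \<rho>" using assms by (auto simp: \<rho>_def)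
  have \<sigma>: "\<sigma> > 1" "\<rho> * \<sigma> < 1" using \<rho> by (auto simp: \<sigma>_def field_simps)
  \<comment> \<open>\<open>x\<close> is the rate in \<open>n\<close> before the binomial coefficient is counted; any \<open>y\<close> with
    \<open>0 < y < 1 - x\<close> would do, and the rate in \<open>n\<close> becomes \<open>x + y\<close>.\<close>
  define x where "x = \<rho> * \<sigma>"
  define y where "y = (1 - x) / 2"
  have xy: "0 < x" "x < 1" "0 < y" "x + y < 1"
    using \<rho> \<sigma> mult_pos_pos[of \<rho> \<sigma>] by (simp_all add: y_def x_def field_simps)
  obtain C1 where C1: "C1 > 0"
    "\<And>n. norm (pochhammer \<gamma>\<^sub>1 (2 * n) * of_real z ^ n / (pochhammer \<gamma>\<^sub>3 n * pochhammer \<gamma>\<^sub>4 n)) \<le> C1 * \<rho> ^ n"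
    using pochhammer_quotient_bound[OF \<rho>(3), of \<gamma>\<^sub>1 \<gamma>\<^sub>3 \<gamma>\<^sub>4] by blast
  obtain C2 where C2: "C2 > 0" "\<And>m. norm (pochhammer \<gamma>\<^sub>2 m / fact m) \<le> C2 * \<sigma> ^ m"
    using pochhammer_over_fact_bound[OF \<sigma>(1), of \<gamma>\<^sub>2] by blast
  have "norm (IKonhauser_coeff \<gamma>\<^sub>1 \<gamma>\<^sub>2 \<gamma>\<^sub>3 \<gamma>\<^sub>4 z l n) \<le> (C1 * C2) * (\<sigma> * ((x + y) / y)) ^ l * (x + y) ^ n" for l n
  proof -
    have bin: "of_nat ((l + n) choose n) = (fact (l + n) / (fact n * fact l) :: real)"
      by (simp add: binomial_fact)
    have "norm (IKonhauser_coeff \<gamma>\<^sub>1 \<gamma>\<^sub>2 \<gamma>\<^sub>3 \<gamma>\<^sub>4 z l n) =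
        norm (pochhammer \<gamma>\<^sub>1 (2 * n) * of_real z ^ n / (pochhammer \<gamma>\<^sub>3 n * pochhammer \<gamma>\<^sub>4 n))
        * norm (pochhammer \<gamma>\<^sub>2 (l + n) / fact (l + n)) * of_nat ((l + n) choose n)"
      by (simp add: bin IKonhauser_coeff_def norm_mult norm_divide norm_power mult_ac)
    also have "\<dots> \<le> (C1 * \<rho> ^ n) * (C2 * \<sigma> ^ (l + n)) * of_nat ((l + n) choose n)"
      using C1 C2 \<rho> \<sigma> by (intro mult_right_mono mult_mono) auto
    also have "\<dots> = (C1 * C2) * (\<sigma> / y) ^ l * (of_nat ((l + n) choose n) * x ^ n * y ^ l)"
      using xy by (simp add: x_def power_add power_mult_distrib power_divide)
    also have "\<dots> \<le> (C1 * C2) * (\<sigma> / y) ^ l * (x + y) ^ (l + n)"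
      using C1 C2 xy \<sigma> by (intro mult_left_mono binomial_mult_powers_le) auto
    also have "\<dots> = (C1 * C2) * (\<sigma> * ((x + y) / y)) ^ l * (x + y) ^ n"
      by (simp add: power_add power_mult_distrib power_divide)
    finally show ?thesis .
  qed
  moreover have "C1 * C2 > 0" "\<sigma> * ((x + y) / y) > 0" "0 < x + y" "x + y < 1"
    using C1 C2 xy \<sigma> by auto
  ultimately show ?thesis by blast
qed

section \<open>The complex Beta integral\<close>

lemma set_integrable_Beta_complex:
  fixes a b :: complex
  assumes "Re a > 0" "Re b > 0"
  shows "set_integrable lborel {0<..<1} (\<lambda>x. of_real (1 - x) powr (a - 1) * of_real x powr (b - 1))"
  unfolding set_integrable_def
proof (rule Bochner_Integration.integrable_bound)
  show "integrable lborel (\<lambda>x. indicat_real {0..1} x *\<^sub>R (x powr (Re b - 1) * (1 - x) powr (Re a - 1)))"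
    using integrable_Beta[of "Re b" "Re a"] assms by (simp add: set_integrable_def)
  show "(\<lambda>x. indicator {0<..<1} x *\<^sub>R (of_real (1 - x) powr (a - 1) * complex_of_real x powr (b - 1)))
          \<in> borel_measurable lborel"
    by (auto intro!: borel_measurable_continuous_on_indicator continuous_intros simp flip: of_real_diff)
qed (auto simp: indicator_def norm_mult norm_powr_real_powr simp flip: of_real_diff)

text \<open>
  The integrand of the substitution \<open>y = c + (t - c) x\<close>, without the factor \<open>t - c\<close> of the
  differential. The identity holds for all real \<open>x\<close>, so that it transports integrals as well as
  integrability.
\<close>

lemma power_kernel_scaling:
  fixes a b :: complex and c t :: real
  assumes "c < t"
  shows "indicator {c<..<t} (c + (t - c) * x)
            *\<^sub>R (of_real (t - (c + (t - c) * x)) powr (a - 1) * of_real (c + (t - c) * x - c) powr (b - 1))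
         = of_real (t - c) powr (a + b - 2) *
            (indicator {0<..<1} x *\<^sub>R (of_real (1 - x) powr (a - 1) * complex_of_real x powr (b - 1)))"
proof -
  have iff: "c + (t - c) * x \<in> {c<..<t} \<longleftrightarrow> x \<in> {0<..<1}"
  proof -
    have "(t - c) * x < t - c \<longleftrightarrow> x < 1" using assms by simp
    moreover have "c + (t - c) * x < t \<longleftrightarrow> (t - c) * x < t - c" by linarith
    ultimately show ?thesis using assms by (auto simp: zero_less_mult_iff)
  qed
  show ?thesis
  proof (cases "x \<in> {0<..<1}")
    case True
    have e: "t - (c + (t - c) * x) = (t - c) * (1 - x)" "c + (t - c) * x - c = (t - c) * x"
      by (auto simp: algebra_simps)
    have split: "of_real ((t - c) * r) powr e = of_real (t - c) powr e * complex_of_real r powr e"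
      if "r > 0" for r e using that assms
      unfolding of_real_mult by (intro powr_times_real) auto
    have "complex_of_real (t - c) powr (a - 1) * of_real (t - c) powr (b - 1)
        = of_real (t - c) powr (a + b - 2)"
      by (simp flip: powr_add add: algebra_simps)
    moreover have "complex_of_real ((t - c) * (1 - x)) powr (a - 1) * of_real ((t - c) * x) powr (b - 1)
        = (of_real (t - c) powr (a - 1) * of_real (t - c) powr (b - 1))
           * (of_real (1 - x) powr (a - 1) * of_real x powr (b - 1))"
      using True split[of "1 - x"] split[of x] by (simp only: greaterThanLessThan_iff) simp
    ultimately show ?thesis using True iff unfolding e by simp
  qed (use iff in auto)
qed

lemma power_kernel_integral_scaled:
  fixes a b :: complex and c t :: real
  assumes "c < t"
  shows "(LINT y:{c<..<t}|lborel. of_real (t - y) powr (a - 1) * complex_of_real (y - c) powr (b - 1))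
         = of_real (t - c) powr (a + b - 1)
            * (LINT x:{0<..<1}|lborel. of_real (1 - x) powr (a - 1) * complex_of_real x powr (b - 1))"
proof -
  have "t - c \<noteq> 0" using assms by simp
  have "of_real (t - c) powr (a + b - 1) = of_real (t - c) * complex_of_real (t - c) powr (a + b - 2)"
    using assms powr_add[of "complex_of_real (t - c)" 1 "a + b - 2"] by simp
  moreover have "(LINT y:{c<..<t}|lborel. of_real (t - y) powr (a - 1) * complex_of_real (y - c) powr (b - 1))
    = (t - c) *\<^sub>R (LBINT x. of_real (t - c) powr (a + b - 2) *
            (indicator {0<..<1} x *\<^sub>R (of_real (1 - x) powr (a - 1) * complex_of_real x powr (b - 1))))"
    unfolding set_lebesgue_integral_def
    by (subst lborel_integral_real_affine[OF \<open>t - c \<noteq> 0\<close>, where t = c])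
       (use assms in \<open>simp only: power_kernel_scaling[OF assms], simp\<close>)
  ultimately show ?thesis
    by (simp add: set_lebesgue_integral_def scaleR_conv_of_real)
qed

lemma set_integrable_power_kernel:
  fixes a b :: complex and c t :: real
  assumes "Re a > 0" "Re b > 0" "c < t"
  shows "set_integrable lborel {c<..<t}
           (\<lambda>y. of_real (t - y) powr (a - 1) * complex_of_real (y - c) powr (b - 1))"
proof -
  have "t - c \<noteq> 0" using assms by simp
  show ?thesis
    unfolding set_integrable_def
    by (subst lborel_integrable_real_affine_iff[OF \<open>t - c \<noteq> 0\<close>, where t = c, symmetric])
       (use set_integrable_Beta_complex[OF assms(1,2)] in
         \<open>simp only: power_kernel_scaling[OF assms(3)] set_integrable_def integrable_mult_right\<close>)
qed

text \<open>
  The integrand of Euler's integral, extended by zero to the whole line so that convolutions can be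
  taken over \<open>lborel\<close>.
\<close>

definition Gamma_density :: "complex \<Rightarrow> real \<Rightarrow> complex" where
  "Gamma_density a t = indicator {0<..} t *\<^sub>R (of_real t powr (a - 1) / of_real (exp t))"

lemma measurable_Gamma_density [measurable]: "Gamma_density a \<in> borel_measurable borel"
  unfolding Gamma_density_def
  by (auto intro!: borel_measurable_continuous_on_indicator continuous_intros)

lemma has_bochner_integral_Gamma_density:
  assumes "Re a > 0"
  shows "has_bochner_integral lborel (Gamma_density a) (Gamma a)"
proof -
  have "integrable lebesgue (Gamma_density a)"
    using absolutely_integrable_Gamma_integral'[OF assms]
    by (simp add: set_integrable_def Gamma_density_def[abs_def])
  then have int: "integrable lborel (Gamma_density a)"
    by (subst (asm) integrable_completion) auto
  have si: "set_integrable lborel {0<..} (\<lambda>t. complex_of_real t powr (a - 1) / of_real (exp t))"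
    using int by (simp add: set_integrable_def Gamma_density_def[abs_def])
  have "integral\<^sup>L lborel (Gamma_density a)
      = (LINT t:{0<..}|lborel. complex_of_real t powr (a - 1) / of_real (exp t))"
    by (simp add: set_lebesgue_integral_def Gamma_density_def[abs_def])
  also have "\<dots> = Gamma a"
    using set_borel_integral_eq_integral(2)[OF si] integral_unique[OF Gamma_integral_complex'[OF assms]]
    by simp
  finally show ?thesis using int by (simp add: has_bochner_integral_iff)
qed

text \<open>
  On \<open>0 < t < u\<close> the exponentials combine to \<open>exp (- u)\<close>, and what is left is the power kernel
  on \<open>{0<..<u}\<close>, a multiple of the one on \<open>{0<..<1}\<close>.
\<close>

lemma convolution_Gamma_density:
  fixes a b :: complex
  shows "(LBINT t. Gamma_density a (u - t) * Gamma_density b t)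
         = Gamma_density (a + b) u
            * (LINT x:{0<..<1}|lborel. of_real (1 - x) powr (a - 1) * complex_of_real x powr (b - 1))"
proof (cases "u > 0")
  case True
  have "Gamma_density a (u - t) * Gamma_density b t =
     (indicator {0<..<u} t *\<^sub>R (of_real (u - t) powr (a - 1) * complex_of_real (t - 0) powr (b - 1)))
      / of_real (exp u)" for t
    by (auto simp: Gamma_density_def indicator_def exp_diff field_simps simp flip: of_real_mult)
  then have "(LBINT t. Gamma_density a (u - t) * Gamma_density b t)
     = (LINT t:{0<..<u}|lborel. of_real (u - t) powr (a - 1) * complex_of_real (t - 0) powr (b - 1))
         / of_real (exp u)"
    by (simp add: set_lebesgue_integral_def)
  then show ?thesis
    using True by (simp only: power_kernel_integral_scaled[OF True]) (simp add: Gamma_density_def)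
next
  case False
  then have "Gamma_density a (u - t) * Gamma_density b t = 0" for t
    by (auto simp: Gamma_density_def indicator_def)
  then have "(LBINT t. Gamma_density a (u - t) * Gamma_density b t) = 0" by (simp only: integral_zero)
  then show ?thesis using False by (simp add: Gamma_density_def)
qed

text \<open>
  The total mass of a convolution is the product of the total masses. By Fubini's theorem it is
  \<open>Gamma a * Gamma b\<close>, and by the shape of the convolution it is \<open>Gamma (a + b)\<close> times the Beta
  integral.
\<close>

lemma Beta_integral_complex:
  fixes a b :: complex
  assumes a: "Re a > 0" and b: "Re b > 0"
  shows "(LINT x:{0<..<1}|lborel. of_real (1 - x) powr (a - 1) * complex_of_real x powr (b - 1)) = Beta a b"
    (is "?B = _")
proof -
  have ab: "Re (a + b) > 0" using assms by simp
  note G = has_bochner_integral_Gamma_density[unfolded has_bochner_integral_iff]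
  have shift: "(LBINT u. h (u - t)) = (LBINT u. h u)" for h :: "real \<Rightarrow> 'c::{banach, second_countable_topology}" and t
    using lborel_integral_real_affine[of 1 h "- t"] by simp
  have shift_int: "integrable lborel (\<lambda>u. Gamma_density a (u - t))" for t
    using lborel_integrable_real_affine[of "Gamma_density a" 1 "- t"] G[OF a] by simp
  let ?F = "\<lambda>(t, u). Gamma_density a (u - t) * Gamma_density b t"
  have "integrable (lborel \<Otimes>\<^sub>M lborel) ?F"
  proof (rule lborel_pair.Fubini_integrable)
    have "(\<lambda>t. LBINT u. norm (?F (t, u)))
        = (\<lambda>t. norm (Gamma_density b t) * (LBINT u. norm (Gamma_density a u)))"
      using shift[of "\<lambda>u. norm (Gamma_density a u)"] by (auto simp: norm_mult mult.commute)
    then show "integrable lborel (\<lambda>t. LBINT u. norm (?F (t, u)))"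
      using G[OF b] by (auto intro!: integrable_mult_left integrable_norm)
    show "AE t in lborel. integrable lborel (\<lambda>u. ?F (t, u))"
      using shift_int by (auto intro!: integrable_mult_left)
  qed simp
  then have "(LBINT u. LBINT t. Gamma_density a (u - t) * Gamma_density b t)
      = (LBINT t. LBINT u. Gamma_density a (u - t) * Gamma_density b t)"
    by (rule lborel_pair.Fubini_integral)
  also have "\<dots> = Gamma a * Gamma b"
    using shift[of "Gamma_density a"] G[OF a] G[OF b] by simp
  also have "(LBINT u. LBINT t. Gamma_density a (u - t) * Gamma_density b t) = Gamma (a + b) * ?B"
    using G[OF ab] by (simp add: convolution_Gamma_density)
  finally have "Gamma (a + b) * ?B = Gamma a * Gamma b" .
  moreover have "Gamma (a + b) \<noteq> 0"
    using ab by (rule Gamma_nonzero_right_half_plane)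
  ultimately show ?thesis by (simp add: Beta_def field_simps)
qed

lemma power_kernel_integral:
  fixes a b :: complex and c t :: real
  assumes "Re a > 0" "Re b > 0" "c < t"
  shows "(LINT y:{c<..<t}|lborel. of_real (t - y) powr (a - 1) * complex_of_real (y - c) powr (b - 1))
         = of_real (t - c) powr (a + b - 1) * Beta a b"
  by (simp only: power_kernel_integral_scaled[OF assms(3)] Beta_integral_complex[OF assms(1,2)])

section \<open>Termwise fractional integration of power series\<close>

text \<open>
  The power rule \<open>s powr (e - 1) \<mapsto> Gamma e / Gamma (e + \<tau>) * s powr (e + \<tau> - 1)\<close>, applied under the
  sum. The exchange is dominated: the \<open>l\<close>-th term is at most the constant
  \<open>\<bar>c l\<bar> * (t - b) powr (Re \<upsilon> * l)\<close> times the modulus of the integrable kernel with exponents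
  \<open>\<tau> - 1\<close> and \<open>q - 1\<close>.
\<close>

lemma RL_power_series:
  fixes c :: "nat \<Rightarrow> complex" and q \<upsilon> \<tau> :: complex and b t :: real
  assumes "Re q > 0" "Re \<upsilon> \<ge> 0" "Re \<tau> > 0" "b < t"
    and summable: "summable (\<lambda>l. norm (c l) * (t - b) powr (Re \<upsilon> * real l))"
  defines "h \<equiv> \<lambda>y. of_real (y - b) powr (q - 1)
                     * (\<Sum>l. c l * of_real (y - b) powr (\<upsilon> * of_nat l))"
  shows "RL_integrable b \<tau> h t"
    and "RL_integral b \<tau> h t = of_real (t - b) powr (q + \<tau> - 1)
           * (\<Sum>l. c l * (Gamma (q + \<upsilon> * of_nat l) / Gamma (q + \<tau> + \<upsilon> * of_nat l))
                    * of_real (t - b) powr (\<upsilon> * of_nat l))"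
proof -
  define k :: "real \<Rightarrow> complex" where
    "k = (\<lambda>y. indicator {b<..<t} y *\<^sub>R (of_real (t - y) powr (\<tau> - 1) * of_real (y - b) powr (q - 1)))"
  define f :: "nat \<Rightarrow> real \<Rightarrow> complex" where
    "f = (\<lambda>l y. indicator {b<..<t} y *\<^sub>R (c l * (of_real (t - y) powr (\<tau> - 1)
                   * of_real (y - b) powr (q + \<upsilon> * of_nat l - 1))))"
  define d where "d = (\<lambda>l. norm (c l) * (t - b) powr (Re \<upsilon> * real l))"
  have d: "summable d" using summable by (simp add: d_def)
  have Re_pos: "Re (q + \<upsilon> * of_nat l) > 0" for l
    using assms by (simp add: add_pos_nonneg)
  have Gamma_nz: "Gamma (q + \<tau> + \<upsilon> * of_nat l) \<noteq> 0" "Gamma \<tau> \<noteq> 0" for l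
    using Re_pos[of l] \<open>Re \<tau> > 0\<close> by (intro Gamma_nonzero_right_half_plane; simp)+
  have k_int: "integrable lborel k"
    using set_integrable_power_kernel[of \<tau> q b t] assms by (simp add: set_integrable_def k_def)
  have f_int: "integrable lborel (f l)" for l
    using set_integrable_mult_right[OF set_integrable_power_kernel[OF \<open>Re \<tau> > 0\<close> Re_pos \<open>b < t\<close>, of l]]
    by (simp add: set_integrable_def f_def)
  have coeff_bound: "norm (c l * of_real (y - b) powr (\<upsilon> * of_nat l)) \<le> d l"
    if "y \<in> {b<..<t}" for y l
    using that assms
    by (auto simp: d_def norm_mult norm_powr_real_powr intro!: mult_left_mono powr_mono2 simp flip: of_real_diff)
  have f_eq: "f l y = k y * (c l * of_real (y - b) powr (\<upsilon> * of_nat l))" for l y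
  proof (cases "y \<in> {b<..<t}")
    case True
    have "q + \<upsilon> * of_nat l - 1 = (q - 1) + \<upsilon> * of_nat l" by simp
    then show ?thesis by (simp only: f_def k_def powr_add) (simp add: mult_ac)
  qed (simp add: f_def k_def)
  have f_bound: "norm (f l y) \<le> d l * norm (k y)" for l y
  proof (cases "y \<in> {b<..<t}")
    case True
    then show ?thesis
      unfolding f_eq norm_mult[of "k y"] using coeff_bound[OF True, of l]
      by (subst mult.commute) (intro mult_right_mono, auto)
  qed (simp add: f_def k_def)
  have f_abs: "summable (\<lambda>l. norm (f l y))" for y
    by (rule summable_comparison_test'[OF summable_mult2[OF d, of "norm (k y)"], of 0])
       (use f_bound in auto)
  have "summable (\<lambda>l. LBINT y. norm (f l y))"
  proof (rule summable_comparison_test'[OF summable_mult2[OF d, of "LBINT y. norm (k y)"], of 0])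
    fix l
    have "(LBINT y. norm (f l y)) \<le> (LBINT y. d l * norm (k y))"
      using f_int k_int f_bound by (intro integral_mono) auto
    then show "norm (LBINT y. norm (f l y)) \<le> d l * (LBINT y. norm (k y))"
      by simp
  qed
  note exchange = integrable_suminf[OF f_int AE_I2[OF f_abs] this]
    integral_suminf[OF f_int AE_I2[OF f_abs] this]
  have sum_f: "(\<Sum>l. f l y) = indicator {b<..<t} y *\<^sub>R (of_real (t - y) powr (\<tau> - 1) * h y)" for y
  proof (cases "y \<in> {b<..<t}")
    case True
    have "summable (\<lambda>l. c l * of_real (y - b) powr (\<upsilon> * of_nat l))"
      by (rule summable_comparison_test'[OF d, of 0]) (use coeff_bound[OF True] in auto)
    then have "(\<Sum>l. f l y) = k y * (\<Sum>l. c l * of_real (y - b) powr (\<upsilon> * of_nat l))"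
      unfolding f_eq by (rule suminf_mult)
    then show ?thesis by (simp add: k_def h_def mult_ac)
  qed (simp add: f_def)
  show "RL_integrable b \<tau> h t"
    using exchange(1) by (simp add: RL_integrable_def set_integrable_def sum_f)
  have integral_f: "1 / Gamma \<tau> * (LBINT y. f l y) = of_real (t - b) powr (q + \<tau> - 1)
      * (c l * (Gamma (q + \<upsilon> * of_nat l) / Gamma (q + \<tau> + \<upsilon> * of_nat l))
           * of_real (t - b) powr (\<upsilon> * of_nat l))" for l
  proof -
    have "f l = (\<lambda>y. c l * (indicator {b<..<t} y *\<^sub>R (of_real (t - y) powr (\<tau> - 1)
                   * of_real (y - b) powr (q + \<upsilon> * of_nat l - 1))))"
      by (simp add: f_def)
    then have "(LBINT y. f l y) = c l * (LINT y:{b<..<t}|lborel. of_real (t - y) powr (\<tau> - 1)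
                   * of_real (y - b) powr (q + \<upsilon> * of_nat l - 1))"
      by (simp only: integral_mult_right_zero set_lebesgue_integral_def)
    also have "\<dots> = c l * (of_real (t - b) powr (\<tau> + (q + \<upsilon> * of_nat l) - 1)
                                    * Beta \<tau> (q + \<upsilon> * of_nat l))"
      by (simp only: power_kernel_integral[OF \<open>Re \<tau> > 0\<close> Re_pos \<open>b < t\<close>])
    also have "\<tau> + (q + \<upsilon> * of_nat l) - 1 = (q + \<tau> - 1) + \<upsilon> * of_nat l" by simp
    finally show ?thesis
      using Gamma_nz by (simp only: powr_add) (simp add: Beta_def add_ac)
  qed
  have summable_int: "summable (\<lambda>l. LBINT y. f l y)"
    using summable_integral[OF f_int AE_I2[OF f_abs]] \<open>summable (\<lambda>l. LBINT y. norm (f l y))\<close> by blast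
  have nz: "complex_of_real (t - b) powr (q + \<tau> - 1) \<noteq> 0" using \<open>b < t\<close> by simp
  have "RL_integral b \<tau> h t = 1 / Gamma \<tau> * (\<Sum>l. LBINT y. f l y)"
    using exchange(2) by (simp add: RL_integral_def set_lebesgue_integral_def sum_f)
  also have "\<dots> = (\<Sum>l. 1 / Gamma \<tau> * (LBINT y. f l y))"
    by (rule suminf_mult[symmetric, OF summable_int])
  also have "\<dots> = of_real (t - b) powr (q + \<tau> - 1)
           * (\<Sum>l. c l * (Gamma (q + \<upsilon> * of_nat l) / Gamma (q + \<tau> + \<upsilon> * of_nat l))
                    * of_real (t - b) powr (\<upsilon> * of_nat l))"
  proof -
    have "summable (\<lambda>l. 1 / Gamma \<tau> * (LBINT y. f l y))" by (rule summable_mult[OF summable_int])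
    then show ?thesis
      unfolding integral_f by (rule suminf_mult[OF summable_mult_D[OF _ nz]])
  qed
  finally show "RL_integral b \<tau> h t = of_real (t - b) powr (q + \<tau> - 1)
           * (\<Sum>l. c l * (Gamma (q + \<upsilon> * of_nat l) / Gamma (q + \<tau> + \<upsilon> * of_nat l))
                    * of_real (t - b) powr (\<upsilon> * of_nat l))" .
qed

section \<open>The Mittag-Leffler series as a power series\<close>

lemma summable_IKonhauser_coeff:
  assumes "\<bar>z\<bar> < 1 / 4"
  shows "summable (IKonhauser_coeff \<gamma>\<^sub>1 \<gamma>\<^sub>2 \<gamma>\<^sub>3 \<gamma>\<^sub>4 z l)"
proof -
  obtain C R \<eta> where \<eta>: "0 < \<eta>" "\<eta> < 1"
    and bound: "\<And>l n. norm (IKonhauser_coeff \<gamma>\<^sub>1 \<gamma>\<^sub>2 \<gamma>\<^sub>3 \<gamma>\<^sub>4 z l n) \<le> C * R ^ l * \<eta> ^ n"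
    using IKonhauser_coeff_bound[OF assms, of \<gamma>\<^sub>1 \<gamma>\<^sub>2 \<gamma>\<^sub>3 \<gamma>\<^sub>4] by blast
  have "summable (\<lambda>n. C * R ^ l * \<eta> ^ n)"
    using \<eta> by (intro summable_mult summable_geometric) auto
  then show ?thesis by (rule summable_comparison_test'[of _ 0]) (use bound in auto)
qed

lemma IKonhauser_coeff_sum_bound:
  assumes "\<bar>z\<bar> < 1 / 4"
  shows "\<exists>C R. R > 0 \<and> (\<forall>l. norm (\<Sum>n. IKonhauser_coeff \<gamma>\<^sub>1 \<gamma>\<^sub>2 \<gamma>\<^sub>3 \<gamma>\<^sub>4 z l n) \<le> C * R ^ l)"
proof -
  obtain C R \<eta> where \<eta>: "0 < \<eta>" "\<eta> < 1" and "R > 0"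
    and bound: "\<And>l n. norm (IKonhauser_coeff \<gamma>\<^sub>1 \<gamma>\<^sub>2 \<gamma>\<^sub>3 \<gamma>\<^sub>4 z l n) \<le> C * R ^ l * \<eta> ^ n"
    using IKonhauser_coeff_bound[OF assms, of \<gamma>\<^sub>1 \<gamma>\<^sub>2 \<gamma>\<^sub>3 \<gamma>\<^sub>4] by blast
  have "norm (\<Sum>n. IKonhauser_coeff \<gamma>\<^sub>1 \<gamma>\<^sub>2 \<gamma>\<^sub>3 \<gamma>\<^sub>4 z l n) \<le> C / (1 - \<eta>) * R ^ l" for l
  proof -
    have "(\<lambda>n. C * R ^ l * \<eta> ^ n) sums (C * R ^ l * (1 / (1 - \<eta>)))"
      using \<eta> by (intro sums_mult geometric_sums) auto
    then have "norm (\<Sum>n. IKonhauser_coeff \<gamma>\<^sub>1 \<gamma>\<^sub>2 \<gamma>\<^sub>3 \<gamma>\<^sub>4 z l n) \<le> C * R ^ l * (1 / (1 - \<eta>))"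
      using norm_suminf_le[of "IKonhauser_coeff \<gamma>\<^sub>1 \<gamma>\<^sub>2 \<gamma>\<^sub>3 \<gamma>\<^sub>4 z l"] bound
      by (metis sums_summable sums_unique)
    then show ?thesis by (simp add: mult_ac)
  qed
  then show ?thesis using \<open>R > 0\<close> by blast
qed

lemma IKonhauser_ML_eq_power_series:
  assumes "\<bar>z\<bar> < 1 / 4"
  shows "IKonhauser_ML \<gamma>\<^sub>1 \<gamma>\<^sub>2 \<gamma>\<^sub>3 \<gamma>\<^sub>4 q \<upsilon> z W s =
    (\<Sum>l. (\<Sum>n. IKonhauser_coeff \<gamma>\<^sub>1 \<gamma>\<^sub>2 \<gamma>\<^sub>3 \<gamma>\<^sub>4 z l n) * W ^ l / Gamma (q + \<upsilon> * of_nat l)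
          * of_real s powr (\<upsilon> * of_nat l))"
  unfolding IKonhauser_ML_def
proof (rule suminf_cong)
  fix l
  have "(\<Sum>n. IKonhauser_coeff \<gamma>\<^sub>1 \<gamma>\<^sub>2 \<gamma>\<^sub>3 \<gamma>\<^sub>4 z l n
               * (W ^ l * of_real s powr (\<upsilon> * of_nat l) / Gamma (q + \<upsilon> * of_nat l)))
      = (\<Sum>n. IKonhauser_coeff \<gamma>\<^sub>1 \<gamma>\<^sub>2 \<gamma>\<^sub>3 \<gamma>\<^sub>4 z l n)
               * (W ^ l * of_real s powr (\<upsilon> * of_nat l) / Gamma (q + \<upsilon> * of_nat l))"
    by (rule suminf_mult2[symmetric, OF summable_IKonhauser_coeff[OF assms]])
  then show "(\<Sum>n. ((-1) ^ n * pochhammer \<gamma>\<^sub>1 (2 * n) * pochhammer \<gamma>\<^sub>2 (l + n)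
                  * of_real z ^ n * (W ^ l * of_real s powr (\<upsilon> * of_nat l)))
               / (pochhammer \<gamma>\<^sub>3 n * pochhammer \<gamma>\<^sub>4 n * Gamma (q + \<upsilon> * of_nat l) * fact n * fact l))
      = (\<Sum>n. IKonhauser_coeff \<gamma>\<^sub>1 \<gamma>\<^sub>2 \<gamma>\<^sub>3 \<gamma>\<^sub>4 z l n) * W ^ l / Gamma (q + \<upsilon> * of_nat l)
          * of_real s powr (\<upsilon> * of_nat l)"
    by (simp add: IKonhauser_coeff_def mult_ac)
qed

lemma summable_over_Gamma:
  fixes a :: "nat \<Rightarrow> complex" and q \<upsilon> :: complex
  assumes "Re q > 0" "Re \<upsilon> > 0" "R > 0" and bound: "\<And>l. norm (a l) \<le> C * R ^ l"
  shows "summable (\<lambda>l. norm (a l / Gamma (q + \<upsilon> * of_nat l)))"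
proof -
  have "C \<ge> 0" using order_trans[OF norm_ge_zero bound[of 0]] by simp
  \<comment> \<open>Doubling \<open>R\<close> leaves a factor \<open>(1 / 2) ^ l\<close> to sum.\<close>
  obtain D where D: "D > 0" "\<forall>\<^sub>F l in sequentially. (2 * R) ^ l \<le> D * norm (Gamma (q + \<upsilon> * of_nat l))"
    using Gamma_arithmetic_progression_superexponential[of q \<upsilon> "2 * R"] assms by auto
  have "\<forall>\<^sub>F l in sequentially. norm (norm (a l / Gamma (q + \<upsilon> * of_nat l))) \<le> C * D * (1 / 2) ^ l"
    using D(2)
  proof eventually_elim
    case (elim l)
    have "0 < (2 * R) ^ l" using \<open>R > 0\<close> by simp
    also note elim
    finally have pos: "norm (Gamma (q + \<upsilon> * of_nat l)) > 0"
      using D(1) by (simp add: zero_less_mult_iff)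
    have "norm (a l) \<le> C * R ^ l" by (rule bound)
    also have "\<dots> = C * (1 / 2) ^ l * (2 * R) ^ l" by (simp add: power_mult_distrib field_simps)
    also have "\<dots> \<le> C * (1 / 2) ^ l * (D * norm (Gamma (q + \<upsilon> * of_nat l)))"
      using \<open>C \<ge> 0\<close> by (intro mult_left_mono elim) auto
    finally show ?case using pos by (simp add: norm_divide pos_divide_le_eq mult_ac)
  qed
  then show ?thesis
    by (rule summable_comparison_test_ev) (intro summable_mult summable_geometric, simp)
qed

theorem theorem20:
  fixes q \<upsilon> \<gamma>\<^sub>1 \<gamma>\<^sub>2 \<gamma>\<^sub>3 \<gamma>\<^sub>4 \<tau> w W :: complex
    and b t z :: real
  assumes "Re q > 0" and "Re \<upsilon> > 0"
    and "\<gamma>\<^sub>3 \<notin> \<int>\<^sub>\<le>\<^sub>0" and "\<gamma>\<^sub>4 \<notin> \<int>\<^sub>\<le>\<^sub>0"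
    and "Re \<tau> > 0"
    and "is_power_value w \<upsilon> W"
    and "t > b"
    and "-1/4 < z" and "z < 1/4"
  shows "RL_integrable b \<tau>
           (\<lambda>y. of_real (y - b) powr (q - 1) * IKonhauser_ML \<gamma>\<^sub>1 \<gamma>\<^sub>2 \<gamma>\<^sub>3 \<gamma>\<^sub>4 q \<upsilon> z W (y - b)) t
       \<and> RL_integral b \<tau>
           (\<lambda>y. of_real (y - b) powr (q - 1) * IKonhauser_ML \<gamma>\<^sub>1 \<gamma>\<^sub>2 \<gamma>\<^sub>3 \<gamma>\<^sub>4 q \<upsilon> z W (y - b)) t
         = of_real (t - b) powr (q + \<tau> - 1)
             * IKonhauser_ML \<gamma>\<^sub>1 \<gamma>\<^sub>2 \<gamma>\<^sub>3 \<gamma>\<^sub>4 (q + \<tau>) \<upsilon> z W (t - b)"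
proof -
  have z: "\<bar>z\<bar> < 1 / 4" using assms by auto
  define A where "A l = (\<Sum>n. IKonhauser_coeff \<gamma>\<^sub>1 \<gamma>\<^sub>2 \<gamma>\<^sub>3 \<gamma>\<^sub>4 z l n)" for l
  define c where "c l = A l * W ^ l / Gamma (q + \<upsilon> * of_nat l)" for l
  define S where "S = (t - b) powr Re \<upsilon>"
  have "S > 0" using assms by (simp add: S_def)
  have S_power: "(t - b) powr (Re \<upsilon> * real l) = S ^ l" for l
    using assms by (simp add: S_def powr_powr[symmetric] powr_realpow)
  obtain C R where "R > 0" and A: "\<And>l. norm (A l) \<le> C * R ^ l"
    using IKonhauser_coeff_sum_bound[OF z, of \<gamma>\<^sub>1 \<gamma>\<^sub>2 \<gamma>\<^sub>3 \<gamma>\<^sub>4] unfolding A_def by blast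
  have "C \<ge> 0" using order_trans[OF norm_ge_zero A[of 0]] by simp
  have "summable (\<lambda>l. norm (A l * W ^ l * of_real S ^ l / Gamma (q + \<upsilon> * of_nat l)))"
  proof (rule summable_over_Gamma)
    \<comment> \<open>The \<open>1\<close> keeps the rate positive when \<open>W = 0\<close>.\<close>
    show "R * (norm W + 1) * S > 0"
      using \<open>R > 0\<close> \<open>S > 0\<close> by (intro mult_pos_pos add_nonneg_pos) auto
    show "norm (A l * W ^ l * of_real S ^ l) \<le> C * (R * (norm W + 1) * S) ^ l" for l
    proof -
      have "norm (A l * W ^ l * of_real S ^ l) = norm (A l) * norm W ^ l * S ^ l"
        using \<open>S > 0\<close> by (simp add: norm_mult norm_power)
      also have "\<dots> \<le> (C * R ^ l) * (norm W + 1) ^ l * S ^ l"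
        using \<open>S > 0\<close> \<open>R > 0\<close> \<open>C \<ge> 0\<close> by (intro mult_mono A power_mono) auto
      finally show ?thesis by (simp add: power_mult_distrib mult_ac)
    qed
  qed (use assms in auto)
  then have summable: "summable (\<lambda>l. norm (c l) * (t - b) powr (Re \<upsilon> * real l))"
    using \<open>S > 0\<close> unfolding S_power
    by (simp add: c_def norm_mult norm_divide norm_power)
  have Gamma_nz: "Gamma (q + \<upsilon> * of_nat l) \<noteq> 0" for l
    using assms by (intro Gamma_nonzero_right_half_plane) (simp add: add_pos_nonneg)
  have E: "IKonhauser_ML \<gamma>\<^sub>1 \<gamma>\<^sub>2 \<gamma>\<^sub>3 \<gamma>\<^sub>4 q \<upsilon> z W s = (\<Sum>l. c l * of_real s powr (\<upsilon> * of_nat l))" for s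
    by (simp only: IKonhauser_ML_eq_power_series[OF z] c_def A_def)
  have E': "IKonhauser_ML \<gamma>\<^sub>1 \<gamma>\<^sub>2 \<gamma>\<^sub>3 \<gamma>\<^sub>4 (q + \<tau>) \<upsilon> z W (t - b) =
      (\<Sum>l. c l * (Gamma (q + \<upsilon> * of_nat l) / Gamma (q + \<tau> + \<upsilon> * of_nat l))
                    * of_real (t - b) powr (\<upsilon> * of_nat l))"
    using Gamma_nz by (simp add: IKonhauser_ML_eq_power_series[OF z] c_def A_def)
  show ?thesis
    unfolding E E' using RL_power_series[OF _ _ _ _ summable, of q \<tau>] assms by simp
qed

end
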